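(* Let $R_U$ be a reduced canonical rewrite system, over a finite set $C$ of constants with total ordering $\gg_C$ and a set $F_U$ of uninterpreted function symbols, consisting of constant rules $c\rightarrow d$ ($c,d\in C$, $c\gg_C d$) and flat rules $h(c_1,\dots,c_k)\rightarrow d$ ($h\in F_U$, $c_i,d\in C$), and let $S_U$ be the set of equations $l=r$ for $l\rightarrow r\in R_U$. Let $\{a_i=b_i\mid 1\le i\le k\}$ be a finite set of equations between constants. Then $R'_U={\bf update_U}(R_U,\{a_i=b_i\mid 1\le i\le k\})$ is a reduced canonical rewrite system for the congruence closure $CC(S_U\cup\{a_i=b_i\mid 1\le i\le k\})$ using $\gg_C$: two ground terms are congruent in this congruence closure iff they have the same normal form with respect to $R'_U$ (terms being flattened by naming nonconstant subterms with constants as in $R_U$).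
   Context: For a set $E$ of ground equations over uninterpreted symbols and constants, $CC(E)$ is the smallest relation on ground terms containing $E$ that is reflexive, symmetric, transitive and closed under function application ($a_i=b_i$ for all $i$ implies $h(a_1,\dots,a_k)=h(b_1,\dots,b_k)$). A rewrite system is canonical if terminating and confluent, and reduced if no left or right side of a rule is reducible by the other rules. (If new constants are involved, $\gg_C$ is extended to them.) Procedure ${\bf update_U}(R_U,\{a_i=b_i\})$: (i) Merge the equivalence classes of constants determined by the constant rules of $R_U$ using the equalities $a_i=b_i$; in each merged class choose its $\gg_C$-least constant as canonical representative, and let the new constant rules rewrite every other constant of the class to this representative. (ii) Replace each constant in each flat rule by its canonical representative; whenever several flat rules $h(c_1,\dots,c_j)\rightarrow d_1,\dots,h(c_1,\dots,c_j)\rightarrow d_l$ have identical left sides, replace them by the single rule $h(c_1,\dots,c_j)\rightarrow d_m$ where $d_m$ is the $\gg_C$-least of $d_1,\dots,d_l$, and add the constant equalities $d_j=d_m$ for $d_j\ne d_m$. If step (ii) generates a new constant equality, repeat (i)–(ii) with the new equalities until no new constant equalities arise; the result is $R'_U$. *)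

theory Defs
  imports "HOL-Library.While_Combinator" "HOL-Library.Confluence"
begin

datatype ('c, 'f) gterm = Const 'c | App 'f "('c, 'f) gterm list"

type_synonym ('c, 'f) rules = "(('c, 'f) gterm \<times> ('c, 'f) gterm) set"

text \<open>A signature is given by a set \<open>C\<close> of constants, a set \<open>F\<close> of function symbols and
  their arities \<open>ar\<close>.\<close>

inductive_set ground_terms :: "'c set \<Rightarrow> 'f set \<Rightarrow> ('f \<Rightarrow> nat) \<Rightarrow> ('c, 'f) gterm set"
  for C :: "'c set" and F :: "'f set" and ar :: "'f \<Rightarrow> nat"
where
  const: "c \<in> C \<Longrightarrow> Const c \<in> ground_terms C F ar"
| app: "\<lbrakk>h \<in> F; length ts = ar h; \<forall>t \<in> set ts. t \<in> ground_terms C F ar\<rbrakk>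
    \<Longrightarrow> App h ts \<in> ground_terms C F ar"

inductive_set CC ::
    "'c set \<Rightarrow> 'f set \<Rightarrow> ('f \<Rightarrow> nat) \<Rightarrow> ('c, 'f) rules \<Rightarrow> (('c, 'f) gterm \<times> ('c, 'f) gterm) set"
  for C :: "'c set" and F :: "'f set" and ar :: "'f \<Rightarrow> nat" and E :: "('c, 'f) rules"
where
  base: "(s, t) \<in> E \<Longrightarrow> (s, t) \<in> CC C F ar E"
| refl: "t \<in> ground_terms C F ar \<Longrightarrow> (t, t) \<in> CC C F ar E"
| sym: "(s, t) \<in> CC C F ar E \<Longrightarrow> (t, s) \<in> CC C F ar E"
| trans: "\<lbrakk>(s, t) \<in> CC C F ar E; (t, u) \<in> CC C F ar E\<rbrakk> \<Longrightarrow> (s, u) \<in> CC C F ar E"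
| cong: "\<lbrakk>h \<in> F; length ss = ar h; length ts = ar h;
     \<forall>i < ar h. (ss ! i, ts ! i) \<in> CC C F ar E\<rbrakk>
    \<Longrightarrow> (App h ss, App h ts) \<in> CC C F ar E"

inductive rstep :: "('c, 'f) rules \<Rightarrow> ('c, 'f) gterm \<Rightarrow> ('c, 'f) gterm \<Rightarrow> bool"
  for R :: "('c, 'f) rules"
where
  root: "(l, r) \<in> R \<Longrightarrow> rstep R l r"
| arg: "rstep R s t \<Longrightarrow> rstep R (App h (us @ s # vs)) (App h (us @ t # vs))"

definition rewrite_step ::
    "'c set \<Rightarrow> 'f set \<Rightarrow> ('f \<Rightarrow> nat) \<Rightarrow> ('c, 'f) rules \<Rightarrow> ('c, 'f) gterm \<Rightarrow> ('c, 'f) gterm \<Rightarrow> bool"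
where
  "rewrite_step C F ar R s t \<longleftrightarrow>
     s \<in> ground_terms C F ar \<and> t \<in> ground_terms C F ar \<and> rstep R s t"

definition reducible ::
    "'c set \<Rightarrow> 'f set \<Rightarrow> ('f \<Rightarrow> nat) \<Rightarrow> ('c, 'f) rules \<Rightarrow> ('c, 'f) gterm \<Rightarrow> bool"
where
  "reducible C F ar R s \<longleftrightarrow> (\<exists>t. rewrite_step C F ar R s t)"

definition normal_form_of ::
    "'c set \<Rightarrow> 'f set \<Rightarrow> ('f \<Rightarrow> nat) \<Rightarrow> ('c, 'f) rules \<Rightarrow> ('c, 'f) gterm \<Rightarrow> ('c, 'f) gterm \<Rightarrow> bool"
where
  "normal_form_of C F ar R t u \<longleftrightarrow> (rewrite_step C F ar R)\<^sup>*\<^sup>* t u \<and> \<not> reducible C F ar R u"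

definition same_normal_form ::
    "'c set \<Rightarrow> 'f set \<Rightarrow> ('f \<Rightarrow> nat) \<Rightarrow> ('c, 'f) rules \<Rightarrow> ('c, 'f) gterm \<Rightarrow> ('c, 'f) gterm \<Rightarrow> bool"
where
  "same_normal_form C F ar R s t \<longleftrightarrow>
     (\<exists>u. normal_form_of C F ar R s u \<and> normal_form_of C F ar R t u)"

definition canonical :: "'c set \<Rightarrow> 'f set \<Rightarrow> ('f \<Rightarrow> nat) \<Rightarrow> ('c, 'f) rules \<Rightarrow> bool" where
  "canonical C F ar R \<longleftrightarrow>
     wfP (rewrite_step C F ar R)\<inverse>\<inverse> \<and> confluentp (rewrite_step C F ar R)"

definition reduced :: "'c set \<Rightarrow> 'f set \<Rightarrow> ('f \<Rightarrow> nat) \<Rightarrow> ('c, 'f) rules \<Rightarrow> bool" where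
  "reduced C F ar R \<longleftrightarrow>
     (\<forall>(l, r) \<in> R. \<not> reducible C F ar (R - {(l, r)}) l \<and> \<not> reducible C F ar (R - {(l, r)}) r)"

text \<open>Throughout, \<open>(c, d) \<in> gt\<close> means that \<open>c\<close> is greater than \<open>d\<close> in the ordering on constants.\<close>

definition is_const_rule ::
    "'c set \<Rightarrow> 'c rel \<Rightarrow> ('c, 'f) gterm \<Rightarrow> ('c, 'f) gterm \<Rightarrow> bool"
where
  "is_const_rule C gt l r \<longleftrightarrow>
     (\<exists>c d. l = Const c \<and> r = Const d \<and> c \<in> C \<and> d \<in> C \<and> (c, d) \<in> gt)"

definition is_flat_rule ::
    "'c set \<Rightarrow> 'f set \<Rightarrow> ('f \<Rightarrow> nat) \<Rightarrow> ('c, 'f) gterm \<Rightarrow> ('c, 'f) gterm \<Rightarrow> bool"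
where
  "is_flat_rule C F ar l r \<longleftrightarrow>
     (\<exists>h cs d. l = App h (map Const cs) \<and> r = Const d \<and>
        h \<in> F \<and> length cs = ar h \<and> set cs \<subseteq> C \<and> d \<in> C)"

definition const_flat_system ::
    "'c set \<Rightarrow> 'c rel \<Rightarrow> 'f set \<Rightarrow> ('f \<Rightarrow> nat) \<Rightarrow> ('c, 'f) rules \<Rightarrow> bool"
where
  "const_flat_system C gt F ar R \<longleftrightarrow>
     (\<forall>(l, r) \<in> R. is_const_rule C gt l r \<or> is_flat_rule C F ar l r)"

definition const_eqs :: "('c \<times> 'c) set \<Rightarrow> ('c, 'f) rules" where
  "const_eqs A = (\<lambda>(a, b). (Const a, Const b)) ` A"

text \<open>Flattening: some nonconstant subterms of a term are replaced, innermost first, by the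
  constants that name them in the flat rules of \<open>R\<close>.\<close>

definition flattens_to ::
    "'c set \<Rightarrow> 'f set \<Rightarrow> ('f \<Rightarrow> nat) \<Rightarrow> ('c, 'f) rules \<Rightarrow> ('c, 'f) gterm \<Rightarrow> ('c, 'f) gterm \<Rightarrow> bool"
where
  "flattens_to C F ar R = (rewrite_step C F ar {(l, r) \<in> R. is_flat_rule C F ar l r})\<^sup>*\<^sup>*"

definition least_const :: "'c rel \<Rightarrow> 'c set \<Rightarrow> 'c" where
  "least_const gt X = (THE d. d \<in> X \<and> (\<forall>e \<in> X. e \<noteq> d \<longrightarrow> (e, d) \<in> gt))"

definition merged_class :: "('c, 'f) rules \<Rightarrow> ('c \<times> 'c) set \<Rightarrow> 'c \<Rightarrow> 'c set" where
  "merged_class R A c =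
     {d. equivclp (\<lambda>a b. (Const a, Const b) \<in> R \<or> (a, b) \<in> A) c d}"

definition rep :: "'c rel \<Rightarrow> ('c, 'f) rules \<Rightarrow> ('c \<times> 'c) set \<Rightarrow> 'c \<Rightarrow> 'c" where
  "rep gt R A c = least_const gt (merged_class R A c)"

definition merged_const_rules ::
    "'c set \<Rightarrow> 'c rel \<Rightarrow> ('c, 'f) rules \<Rightarrow> ('c \<times> 'c) set \<Rightarrow> ('c, 'f) rules"
where
  "merged_const_rules C gt R A =
     {(Const c, Const (rep gt R A c)) | c. c \<in> C \<and> c \<noteq> rep gt R A c}"

definition replaced_flat_rules ::
    "'c rel \<Rightarrow> ('c, 'f) rules \<Rightarrow> ('c \<times> 'c) set \<Rightarrow> ('c, 'f) rules"
where
  "replaced_flat_rules gt R A =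
     {(App h (map Const (map (rep gt R A) cs)), Const (rep gt R A d)) | h cs d.
        (App h (map Const cs), Const d) \<in> R}"

definition least_rhs :: "'c rel \<Rightarrow> ('c, 'f) rules \<Rightarrow> ('c, 'f) gterm \<Rightarrow> 'c" where
  "least_rhs gt N l = least_const gt {d. (l, Const d) \<in> N}"

definition collapsed_flat_rules :: "'c rel \<Rightarrow> ('c, 'f) rules \<Rightarrow> ('c, 'f) rules" where
  "collapsed_flat_rules gt N = {(l, Const (least_rhs gt N l)) | l. l \<in> Domain N}"

definition new_const_eqs :: "'c rel \<Rightarrow> ('c, 'f) rules \<Rightarrow> ('c \<times> 'c) set" where
  "new_const_eqs gt N =
     {(d, least_rhs gt N l) | d l. (l, Const d) \<in> N \<and> d \<noteq> least_rhs gt N l}"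

text \<open>One round of merging classes and normalizing the flat rules; the result is the new rule set together with the
  constant equalities generated by flat rules whose left sides became identical.\<close>

definition update_pass ::
    "'c set \<Rightarrow> 'c rel \<Rightarrow> ('c, 'f) rules \<times> ('c \<times> 'c) set \<Rightarrow> ('c, 'f) rules \<times> ('c \<times> 'c) set"
where
  "update_pass C gt = (\<lambda>(R, A).
     let N = replaced_flat_rules gt R A
     in (merged_const_rules C gt R A \<union> collapsed_flat_rules gt N, new_const_eqs gt N))"

text \<open>The result is \<open>None\<close> iff the iteration does not terminate.\<close>

definition update_U ::
    "'c set \<Rightarrow> 'c rel \<Rightarrow> ('c, 'f) rules \<Rightarrow> ('c \<times> 'c) set \<Rightarrow> ('c, 'f) rules option"
where
  "update_U C gt R A =
     map_option fst
       (while_option (\<lambda>(R, A). A \<noteq> {}) (update_pass C gt) (update_pass C gt (R, A)))"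

end

theory Submission
  imports Defs
begin

text \<open>
  Every pass preserves the congruence closure of the rules together with the pending constant
  equalities, and it produces a flat system that is single-valued and interreduced. For such a
  system bottom-up evaluation computes a normal form of every ground term; it is invariant under
  rewriting and under the congruence closure, which gives confluence and the characterization of
  congruence at once. After the first pass each pending equality relates two distinct irreducible
  constants, so every further pass strictly decreases the number of irreducible constants.
\<close>

section \<open>Congruence closure and rewriting\<close>

lemma CC_subsetI:
  assumes "E \<subseteq> CC C F ar E'"
  shows "CC C F ar E \<subseteq> CC C F ar E'"
proof clarify
  fix s t assume "(s, t) \<in> CC C F ar E"
  then show "(s, t) \<in> CC C F ar E'"
  proof induction
    case (base s t)
    then show ?case using assms by blast
  qed (auto intro: CC.intros)
qed

lemma CC_mono: "E \<subseteq> E' \<Longrightarrow> CC C F ar E \<subseteq> CC C F ar E'"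
  by (rule CC_subsetI) (auto intro: CC.base)

lemma ground_terms_App_iff:
  "App h ts \<in> ground_terms C F ar \<longleftrightarrow>
    h \<in> F \<and> length ts = ar h \<and> set ts \<subseteq> ground_terms C F ar"
  by (auto elim: ground_terms.cases intro: ground_terms.intros)

lemma ground_terms_Const_iff: "Const c \<in> ground_terms C F ar \<longleftrightarrow> c \<in> C"
  by (auto elim: ground_terms.cases intro: ground_terms.intros)

lemma map_Const_eq_iff: "map Const cs = map Const ds \<longleftrightarrow> cs = ds"
  by (rule inj_map_eq_map) (simp add: inj_def)

lemma const_eqs_iff: "(Const a, Const b) \<in> const_eqs A \<longleftrightarrow> (a, b) \<in> A"
  by (auto simp: const_eqs_def)

lemma const_flat_cases:
  assumes "const_flat_system C gt F ar R" "(l, r) \<in> R"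
  obtains (const) c d where "l = Const c" "r = Const d" "c \<in> C" "d \<in> C" "(c, d) \<in> gt"
    | (flat) h cs d where "l = App h (map Const cs)" "r = Const d" "h \<in> F" "length cs = ar h"
        "set cs \<subseteq> C" "d \<in> C"
  using assms unfolding const_flat_system_def is_const_rule_def is_flat_rule_def by blast

text \<open>Groundness of \<open>s\<close> supplies reflexivity for the arguments beside the
  rewritten one, which the congruence rule also asks for.\<close>

lemma rstep_imp_CC:
  assumes "rstep R s t" "s \<in> ground_terms C F ar"
  shows "(s, t) \<in> CC C F ar R"
  using assms
proof induction
  case (root l r)
  then show ?case by (blast intro: CC.base)
next
  case (arg s t h us vs)
  then have *: "h \<in> F" "length (us @ s # vs) = ar h" "(s, t) \<in> CC C F ar R"
    "set us \<subseteq> ground_terms C F ar" "set vs \<subseteq> ground_terms C F ar"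
    unfolding ground_terms_App_iff by auto
  have "\<forall>i < ar h. ((us @ s # vs) ! i, (us @ t # vs) ! i) \<in> CC C F ar R"
  proof (intro allI impI)
    fix i assume "i < ar h"
    \<comment> \<open>Position \<open>i\<close> lies in the prefix, is the rewritten argument, or
      lies in the suffix, where the index is shifted by \<open>Suc (length us)\<close>.\<close>
    then have "i < length us \<or> i = length us \<or>
        (\<exists>j. i = length us + Suc j \<and> j < length vs)"
      using *(2) by (cases "i \<le> length us") (auto intro!: exI[of _ "i - Suc (length us)"])
    then show "((us @ s # vs) ! i, (us @ t # vs) ! i) \<in> CC C F ar R"
      using * by (auto simp: nth_append subset_iff intro!: CC.refl)
  qed
  with * show ?case by (intro CC.cong) auto
qed

lemma rewrite_steps_imp_CC:
  assumes "(rewrite_step C F ar R)\<^sup>*\<^sup>* s t" "s \<in> ground_terms C F ar"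
  shows "(s, t) \<in> CC C F ar R"
  using assms
proof induction
  case base
  then show ?case by (rule CC.refl)
next
  case (step t u)
  then show ?case
    unfolding rewrite_step_def by (blast intro: CC.trans rstep_imp_CC)
qed

lemma rewrite_steps_ground:
  "(rewrite_step C F ar R)\<^sup>*\<^sup>* s t \<Longrightarrow> s \<in> ground_terms C F ar \<Longrightarrow> t \<in> ground_terms C F ar"
  by (induction rule: rtranclp_induct) (auto simp: rewrite_step_def)

lemma rstep_Const_iff:
  "rstep R (Const c) t \<longleftrightarrow> (Const c, t) \<in> R"
  by (auto elim: rstep.cases intro: rstep.root)

lemma rewrite_step_arg:
  assumes "rewrite_step C F ar R s t" "App h (us @ s # vs) \<in> ground_terms C F ar"
  shows "rewrite_step C F ar R (App h (us @ s # vs)) (App h (us @ t # vs))"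
  using assms unfolding rewrite_step_def ground_terms_App_iff by (auto intro: rstep.arg)

lemma rewrite_steps_arg:
  assumes "(rewrite_step C F ar R)\<^sup>*\<^sup>* s t" "App h (us @ s # vs) \<in> ground_terms C F ar"
  shows "(rewrite_step C F ar R)\<^sup>*\<^sup>* (App h (us @ s # vs)) (App h (us @ t # vs))"
  using assms(1)
proof induction
  case (step t u)
  have "App h (us @ t # vs) \<in> ground_terms C F ar"
    using step.IH assms(2) by (rule rewrite_steps_ground)
  with step show ?case by (meson rewrite_step_arg rtranclp.rtrancl_into_rtrancl)
qed simp

text \<open>Arguments are rewritten from left to right. The prefix \<open>us\<close> holds those
  already processed, so the induction has to generalize over it.\<close>

lemma rewrite_steps_args:
  assumes "\<And>t. t \<in> set vs \<Longrightarrow> (rewrite_step C F ar R)\<^sup>*\<^sup>* t (f t)"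
    and "App h (us @ vs) \<in> ground_terms C F ar"
  shows "(rewrite_step C F ar R)\<^sup>*\<^sup>* (App h (us @ vs)) (App h (us @ map f vs))"
  using assms
proof (induction vs arbitrary: us)
  case (Cons v vs)
  have 1: "(rewrite_step C F ar R)\<^sup>*\<^sup>* (App h (us @ v # vs)) (App h (us @ f v # vs))"
    using Cons.prems by (intro rewrite_steps_arg) auto
  then have "App h (us @ f v # vs) \<in> ground_terms C F ar"
    using Cons.prems(2) by (rule rewrite_steps_ground)
  then have "(rewrite_step C F ar R)\<^sup>*\<^sup>* (App h ((us @ [f v]) @ vs))
      (App h ((us @ [f v]) @ map f vs))"
    using Cons.prems(1) by (intro Cons.IH) auto
  with 1 show ?case by simp
qed simp

section \<open>Termination of flat systems\<close>

text \<open>A constant weighs its rank in \<open>gt\<close>, which is at most \<open>card C\<close>;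
  a function symbol costs one more than that, so a flat rule loses weight whatever its right side
  is. Summing over arguments makes every decrease survive in context.\<close>

fun weight :: "'c set \<Rightarrow> 'c rel \<Rightarrow> ('c, 'f) gterm \<Rightarrow> nat" where
  "weight C gt (Const c) = card {d \<in> C. (c, d) \<in> gt}"
| "weight C gt (App h ts) = Suc (card C) + sum_list (map (weight C gt) ts)"

lemma rstep_weight_less:
  assumes "finite C" "strict_linear_order_on C gt" "const_flat_system C gt F ar R" "rstep R s t"
  shows "weight C gt t < weight C gt s"
  using assms(4)
proof induction
  case (root l r)
  from assms(3) root show ?case
  proof (cases rule: const_flat_cases)
    case (const c d)
    \<comment> \<open>Transitivity gives the inclusion; \<open>d\<close> itself lies only in the
      larger set, by irreflexivity.\<close>
    have "{e \<in> C. (d, e) \<in> gt} \<subset> {e \<in> C. (c, e) \<in> gt}"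
      using assms(2) const
      unfolding strict_linear_order_on_def by (auto simp: irrefl_def dest: transD)
    then show ?thesis
      using const assms(1) by (simp add: psubset_card_mono)
  next
    case (flat h cs d)
    have "card {e \<in> C. (d, e) \<in> gt} \<le> card C"
      by (rule card_mono) (auto simp: assms(1))
    then show ?thesis using flat by simp
  qed
next
  case (arg s t h us vs)
  then show ?case by simp
qed

lemma const_flat_terminating:
  assumes "finite C" "strict_linear_order_on C gt" "const_flat_system C gt F ar R"
  shows "wfP (rewrite_step C F ar R)\<inverse>\<inverse>"
proof -
  have "wfP (\<lambda>x y. weight C gt x < weight C gt (y :: ('a, 'b) gterm))"
    using wf_measure[of "weight C gt"] by (simp add: wfp_def measure_def inv_image_def)
  then show ?thesis
    by (rule wfp_on_mono_strong)
      (auto simp: rewrite_step_def intro: rstep_weight_less[OF assms])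
qed

section \<open>Normal forms of interreduced flat systems\<close>

text \<open>A purely syntactic condition. In a flat system two rules can overlap only by sharing a
  left side or by a constant rule acting on an argument of a flat left side; the first and third
  conjuncts make both harmless. The second makes right sides final.\<close>

definition interreduced :: "('c, 'f) rules \<Rightarrow> bool" where
  "interreduced R \<longleftrightarrow> single_valued R \<and>
     (\<forall>l d. (l, Const d) \<in> R \<longrightarrow> Const d \<notin> Domain R) \<and>
     (\<forall>h cs r. (App h (map Const cs), r) \<in> R \<longrightarrow> (\<forall>c \<in> set cs. Const c \<notin> Domain R))"

text \<open>At most one root step is taken: in an interreduced flat system its result is already
  irreducible, and single-valuedness makes the description well defined.\<close>

definition root_reduct :: "('c, 'f) rules \<Rightarrow> ('c, 'f) gterm \<Rightarrow> ('c, 'f) gterm" where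
  "root_reduct R t = (if t \<in> Domain R then THE r. (t, r) \<in> R else t)"

fun nf :: "('c, 'f) rules \<Rightarrow> ('c, 'f) gterm \<Rightarrow> ('c, 'f) gterm" where
  "nf R (Const c) = root_reduct R (Const c)"
| "nf R (App h ts) = root_reduct R (App h (map (nf R) ts))"

lemma root_reduct_rule:
  assumes "single_valued R" "(l, r) \<in> R"
  shows "root_reduct R l = r"
  using assms unfolding root_reduct_def by (auto dest: single_valuedD)

text \<open>Right sides are irreducible constants. A second rule at the root of \<open>l\<close>
  would contradict single-valuedness, and a step below the root would rewrite a constant argument of
  a flat left side.\<close>

lemma interreduced_reduced:
  assumes cf: "const_flat_system C gt F ar R" and ir: "interreduced R"
  shows "reduced C F ar R"
  unfolding reduced_def
proof clarify
  fix l r assume lr: "(l, r) \<in> R"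
  have r: "\<not> rstep (R - {(l, r)}) r u" for u
    using cf lr
  proof (cases rule: const_flat_cases)
    case (const c d)
    then show ?thesis using ir lr unfolding interreduced_def by (auto simp: rstep_Const_iff)
  next
    case (flat h cs d)
    then show ?thesis using ir lr unfolding interreduced_def by (auto simp: rstep_Const_iff)
  qed
  have l: "\<not> rstep (R - {(l, r)}) l u" for u
  proof
    assume st: "rstep (R - {(l, r)}) l u"
    have nroot: "(l, u') \<notin> R - {(l, r)}" for u'
      using ir lr unfolding interreduced_def by (auto dest: single_valuedD)
    from st show False
    proof cases
      case root
      then show False using nroot by blast
    next
      case (arg s t h us vs)
      then obtain cs where cs: "us @ s # vs = map Const cs"
        using const_flat_cases[OF cf lr] by (metis gterm.distinct(1) gterm.inject(2))
      then have "s \<in> set (map Const cs)" by (metis in_set_conv_decomp)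
      then obtain c where c: "s = Const c" "c \<in> set cs" by auto
      then have "Const c \<in> Domain R" using arg by (auto simp: rstep_Const_iff)
      moreover have "Const c \<notin> Domain R"
        using ir lr c cs arg unfolding interreduced_def by metis
      ultimately show False by contradiction
    qed
  qed
  show "\<not> reducible C F ar (R - {(l, r)}) l \<and> \<not> reducible C F ar (R - {(l, r)}) r"
    using l r unfolding reducible_def rewrite_step_def by blast
qed

context
  fixes C :: "'c set" and gt :: "'c rel" and F :: "'f set" and ar :: "'f \<Rightarrow> nat"
    and R :: "('c, 'f) rules"
  assumes cf: "const_flat_system C gt F ar R" and ir: "interreduced R"
begin

text \<open>Evaluation leaves the constant arguments of a flat left side and every right side
  unchanged, so both sides evaluate to \<open>r\<close>.\<close>

lemma nf_rule:
  assumes "(l, r) \<in> R"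
  shows "nf R l = nf R r"
proof -
  have sv: "single_valued R" using ir unfolding interreduced_def by blast
  have irr: "root_reduct R (Const d) = Const d" if "Const d \<notin> Domain R" for d
    using that by (simp add: root_reduct_def)
  from cf assms show ?thesis
  proof (cases rule: const_flat_cases)
    case (const c d)
    then show ?thesis
      using assms ir irr root_reduct_rule[OF sv assms] unfolding interreduced_def by auto
  next
    case (flat h cs d)
    have "Const c \<notin> Domain R" if "c \<in> set cs" for c
      using flat assms ir that unfolding interreduced_def by blast
    then have "map (nf R) (map Const cs) = map Const cs"
      using irr by simp
    then have "nf R l = r" using flat root_reduct_rule[OF sv assms] by (simp del: map_map)
    then show ?thesis
      using flat assms ir irr unfolding interreduced_def by auto
  qed
qed

lemma nf_rstep: "rstep R s t \<Longrightarrow> nf R s = nf R t"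
  by (induction rule: rstep.induct) (auto intro: nf_rule)

lemma nf_rewrite_steps: "(rewrite_step C F ar R)\<^sup>*\<^sup>* s t \<Longrightarrow> nf R s = nf R t"
  by (induction rule: rtranclp_induct) (auto simp: rewrite_step_def dest: nf_rstep)

text \<open>Equality of \<open>nf\<close> values is an equivalence compatible with function
  application, since \<open>nf\<close> of an application depends only on the \<open>nf\<close> of
  its arguments.\<close>

lemma nf_CC: "(s, t) \<in> CC C F ar R \<Longrightarrow> nf R s = nf R t"
proof (induction rule: CC.induct)
  case (cong h ss ts)
  then have "map (nf R) ss = map (nf R) ts" by (intro nth_equalityI) auto
  then show ?case by simp
qed (auto intro: nf_rule)

section \<open>Evaluation is reachable by rewriting and ends in an irreducible term\<close>

lemma root_reduct_steps:
  assumes "t \<in> ground_terms C F ar"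
  shows "(rewrite_step C F ar R)\<^sup>*\<^sup>* t (root_reduct R t)"
proof (cases "t \<in> Domain R")
  case True
  then obtain r where r: "(t, r) \<in> R" by blast
  then have "root_reduct R t = r"
    using ir root_reduct_rule unfolding interreduced_def by blast
  moreover have "r \<in> ground_terms C F ar"
    using cf r by (cases rule: const_flat_cases) (auto simp: ground_terms_Const_iff)
  ultimately show ?thesis
    using r assms by (auto simp: rewrite_step_def intro!: r_into_rtranclp rstep.root)
qed (simp add: root_reduct_def)

lemma rewrite_steps_nf:
  "t \<in> ground_terms C F ar \<Longrightarrow> (rewrite_step C F ar R)\<^sup>*\<^sup>* t (nf R t)"
proof (induction rule: ground_terms.induct)
  case (const c)
  then show ?case by (simp add: root_reduct_steps ground_terms_Const_iff)
next
  case (app h ts)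
  then have g: "App h ts \<in> ground_terms C F ar" by (auto intro: ground_terms.app)
  have 1: "(rewrite_step C F ar R)\<^sup>*\<^sup>* (App h ts) (App h (map (nf R) ts))"
    using rewrite_steps_args[of ts C F ar R "nf R" h "[]"] app g by auto
  then have "App h (map (nf R) ts) \<in> ground_terms C F ar"
    using g by (rule rewrite_steps_ground)
  from 1 root_reduct_steps[OF this] show ?case by simp
qed

text \<open>The hypothesis fits a term whose arguments are already in normal form: it can be
  reducible only at the root.\<close>

lemma root_reduct_irreducible:
  assumes "t \<in> Domain R \<or> (\<forall>u. \<not> rstep R t u)"
  shows "\<not> rstep R (root_reduct R t) u"
proof (cases "t \<in> Domain R")
  case True
  then obtain r where r: "(t, r) \<in> R" by blast
  then have "root_reduct R t = r"
    using ir root_reduct_rule unfolding interreduced_def by blast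
  moreover obtain d where "r = Const d" using cf r by (cases rule: const_flat_cases) auto
  moreover have "Const d \<notin> Domain R" if "r = Const d" for d
    using ir r that unfolding interreduced_def by blast
  ultimately show ?thesis by (auto simp: rstep_Const_iff)
next
  case False
  then show ?thesis using assms by (simp add: root_reduct_def)
qed

lemma nf_irreducible: "\<not> rstep R (nf R t) u"
proof (induction t arbitrary: u)
  case (Const c)
  have "Const c \<in> Domain R \<or> (\<forall>u. \<not> rstep R (Const c) u)"
    by (auto simp: rstep_Const_iff)
  then show ?case by (simp add: root_reduct_irreducible)
next
  case (App h ts)
  have "rstep R (App h (map (nf R) ts)) u \<Longrightarrow> App h (map (nf R) ts) \<in> Domain R" for u
  proof (erule rstep.cases)
    fix s t h' us vs
    assume *: "App h (map (nf R) ts) = App h' (us @ s # vs)" "rstep R s t"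
    then have "s \<in> set (map (nf R) ts)" by simp
    then show ?thesis using App * by auto
  qed auto
  then show ?case by (auto intro!: root_reduct_irreducible)
qed

text \<open>Any two reducts of a ground term have the same \<open>nf\<close>, and each rewrites to
  it. A term that is not ground has no proper reducts, because \<open>rewrite_step\<close> relates
  only ground terms.\<close>

lemma interreduced_confluent: "confluentp (rewrite_step C F ar R)"
proof (rule confluentpI)
  fix x y z
  assume *: "(rewrite_step C F ar R)\<^sup>*\<^sup>* x y" "(rewrite_step C F ar R)\<^sup>*\<^sup>* x z"
  show "\<exists>u. (rewrite_step C F ar R)\<^sup>*\<^sup>* y u \<and> (rewrite_step C F ar R)\<^sup>*\<^sup>* z u"
  proof (cases "x \<in> ground_terms C F ar")
    case True
    then have "y \<in> ground_terms C F ar" "z \<in> ground_terms C F ar"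
      using * by (blast dest: rewrite_steps_ground)+
    moreover have "nf R y = nf R z" using * by (metis nf_rewrite_steps)
    ultimately show ?thesis by (metis rewrite_steps_nf)
  next
    case False
    then have "\<not> rewrite_step C F ar R x v" for v by (simp add: rewrite_step_def)
    then have "y = x" "z = x" using * by (auto elim: converse_rtranclpE)
    then show ?thesis by blast
  qed
qed

lemma CC_iff_same_normal_form:
  assumes "s \<in> ground_terms C F ar" "t \<in> ground_terms C F ar"
  shows "(s, t) \<in> CC C F ar R \<longleftrightarrow> same_normal_form C F ar R s t"
proof
  assume "(s, t) \<in> CC C F ar R"
  then have "nf R s = nf R t" by (rule nf_CC)
  moreover have "normal_form_of C F ar R u (nf R u)" if "u \<in> ground_terms C F ar" for u
    using rewrite_steps_nf[OF that] nf_irreducible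
    unfolding normal_form_of_def reducible_def rewrite_step_def by blast
  ultimately show "same_normal_form C F ar R s t"
    using assms unfolding same_normal_form_def by metis
next
  assume "same_normal_form C F ar R s t"
  then show "(s, t) \<in> CC C F ar R"
    using assms unfolding same_normal_form_def normal_form_of_def
    by (meson CC.sym CC.trans rewrite_steps_imp_CC)
qed

end

section \<open>A single pass\<close>

text \<open>A least element exists by induction on the finite set and is unique by irreflexivity and
  transitivity, so the definite description in \<open>least_const\<close> denotes it.\<close>

lemma least_const_props:
  assumes "finite C" "strict_linear_order_on C gt" "X \<subseteq> C" "X \<noteq> {}"
  shows "least_const gt X \<in> X"
    and "e \<in> X \<Longrightarrow> e \<noteq> least_const gt X \<Longrightarrow> (e, least_const gt X) \<in> gt"
proof -
  let ?P = "\<lambda>d. d \<in> X \<and> (\<forall>e \<in> X. e \<noteq> d \<longrightarrow> (e, d) \<in> gt)"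
  have o: "trans gt" "irrefl gt" "total_on C gt"
    using assms(2) unfolding strict_linear_order_on_def by auto
  have "finite X" using assms by (blast intro: finite_subset)
  then have "\<exists>d. ?P d"
    using assms(4,3)
  proof (induction rule: finite_ne_induct)
    case (insert x G)
    then obtain d where d: "d \<in> G" "\<forall>e \<in> G. e \<noteq> d \<longrightarrow> (e, d) \<in> gt" by auto
    have "x \<noteq> d" using insert d by auto
    \<comment> \<open>The new element is compared with the previous minimum; the smaller of the two
      is the new minimum.\<close>
    then consider "(x, d) \<in> gt" | "(d, x) \<in> gt"
      using o(3) insert.prems d(1) unfolding total_on_def by blast
    then show ?case
    proof cases
      case 1
      then show ?thesis using d by (intro exI[of _ d]) auto
    next
      case 2
      then have "(e, x) \<in> gt" if "e \<in> G" for e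
        using d that o(1) by (cases "e = d") (auto dest: transD)
      then show ?thesis by (intro exI[of _ x]) auto
    qed
  qed auto
  moreover have "d = d'" if "?P d" "?P d'" for d d'
    using that o(1,2) by (metis irrefl_def transD)
  ultimately have "\<exists>!d. ?P d" by blast
  then have "?P (least_const gt X)" unfolding least_const_def by (rule theI')
  then show "least_const gt X \<in> X"
    and "e \<in> X \<Longrightarrow> e \<noteq> least_const gt X \<Longrightarrow> (e, least_const gt X) \<in> gt" by blast+
qed

context
  fixes C :: "'c set" and gt :: "'c rel" and F :: "'f set" and ar :: "'f \<Rightarrow> nat"
    and R :: "('c, 'f) rules" and A :: "('c \<times> 'c) set"
  assumes fin: "finite C" and ord: "strict_linear_order_on C gt"
    and cf: "const_flat_system C gt F ar R" and A: "A \<subseteq> C \<times> C"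
begin

private abbreviation (input) "N \<equiv> replaced_flat_rules gt R A"
private abbreviation (input) "R' \<equiv> fst (update_pass C gt (R, A))"
private abbreviation (input) "A' \<equiv> snd (update_pass C gt (R, A))"

lemma const_rule_cases:
  "(Const a, r) \<in> R \<Longrightarrow> \<exists>b. r = Const b \<and> a \<in> C \<and> b \<in> C \<and> (a, b) \<in> gt"
  using cf by (auto elim: const_flat_cases)

lemma flat_rule_cases:
  "(App h ts, r) \<in> R \<Longrightarrow> \<exists>cs d. ts = map Const cs \<and> r = Const d \<and> h \<in> F \<and> length cs = ar h \<and>
     set cs \<subseteq> C \<and> d \<in> C"
  using cf by (auto elim!: const_flat_cases)

section \<open>Merged classes and their representatives\<close>

lemma merged_class_refl: "c \<in> merged_class R A c"
  by (simp add: merged_class_def)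

lemma merged_class_eq: "d \<in> merged_class R A c \<Longrightarrow> merged_class R A d = merged_class R A c"
  unfolding merged_class_def by (auto intro: equivclp_trans equivclp_sym)

lemma merged_class_const_rule: "(Const a, Const b) \<in> R \<Longrightarrow> b \<in> merged_class R A a"
  unfolding merged_class_def by auto

lemma merged_class_eqn: "(a, b) \<in> A \<Longrightarrow> b \<in> merged_class R A a"
  unfolding merged_class_def by auto

text \<open>Induction along a chain of rules and equations, each used in either direction. No link
  leaves \<open>C\<close>, and each is an instance of the congruence closure.\<close>

lemma merged_class_props:
  assumes "d \<in> merged_class R A c" "c \<in> C"
  shows "d \<in> C \<and> (Const c, Const d) \<in> CC C F ar (R \<union> const_eqs A)"
proof -
  have "equivclp (\<lambda>a b. (Const a, Const b) \<in> R \<or> (a, b) \<in> A) c d"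
    using assms(1) by (simp add: merged_class_def)
  then show ?thesis
  proof (induction rule: equivclp_induct)
    case base
    then show ?case using assms(2) by (auto intro: CC.refl ground_terms.const)
  next
    case (step y z)
    have "(Const y, Const z) \<in> R \<union> const_eqs A \<or> (Const z, Const y) \<in> R \<union> const_eqs A"
      using step(2) by (auto simp: const_eqs_iff)
    then have "(Const y, Const z) \<in> CC C F ar (R \<union> const_eqs A)"
      by (blast intro: CC.base CC.sym)
    moreover have "z \<in> C" using step(2) A by (auto dest: const_rule_cases)
    ultimately show ?case using step.IH by (blast intro: CC.trans)
  qed
qed

lemma rep_in_class: "c \<in> C \<Longrightarrow> rep gt R A c \<in> merged_class R A c"
  unfolding rep_def using merged_class_refl merged_class_props
  by (intro least_const_props(1)[OF fin ord]) auto

lemma rep_in_C: "c \<in> C \<Longrightarrow> rep gt R A c \<in> C"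
  using rep_in_class merged_class_props by blast

lemma rep_gt: "c \<in> C \<Longrightarrow> d \<in> merged_class R A c \<Longrightarrow> d \<noteq> rep gt R A c \<Longrightarrow> (d, rep gt R A c) \<in> gt"
  unfolding rep_def using merged_class_refl merged_class_props
  by (intro least_const_props(2)[OF fin ord]) auto

lemma rep_eq: "d \<in> merged_class R A c \<Longrightarrow> rep gt R A d = rep gt R A c"
  unfolding rep_def by (simp add: merged_class_eq)

lemma rep_idem: "c \<in> C \<Longrightarrow> rep gt R A (rep gt R A c) = rep gt R A c"
  using rep_in_class rep_eq by blast

text \<open>By idempotence of \<open>rep\<close>, every constant in a replaced flat rule is its own
  representative. This is the source of interreducedness after the pass.\<close>

lemma replaced_flat_rule_cases:
  assumes "(l, r) \<in> N"
  shows "\<exists>h cs d. l = App h (map Const cs) \<and> r = Const d \<and> h \<in> F \<and> length cs = ar h \<and>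
    set cs \<subseteq> C \<and> d \<in> C \<and> (\<forall>c \<in> set cs. rep gt R A c = c) \<and> rep gt R A d = d"
proof -
  obtain h cs d where *: "l = App h (map Const (map (rep gt R A) cs))"
    "r = Const (rep gt R A d)" "(App h (map Const cs), Const d) \<in> R"
    using assms unfolding replaced_flat_rules_def by auto
  have "h \<in> F" "length cs = ar h" "set cs \<subseteq> C" "d \<in> C"
    using flat_rule_cases[OF *(3)] by (auto simp: map_Const_eq_iff)
  then show ?thesis using *(1,2) rep_in_C rep_idem
    by (intro exI[of _ h] exI[of _ "map (rep gt R A) cs"] exI[of _ "rep gt R A d"]) auto
qed

lemma least_rhs_props:
  assumes "(l, Const d) \<in> N"
  shows "(l, Const (least_rhs gt N l)) \<in> N"
proof -
  have "{d. (l, Const d) \<in> N} \<subseteq> C" using replaced_flat_rule_cases by fastforce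
  then show ?thesis
    using least_const_props(1)[OF fin ord, of "{d. (l, Const d) \<in> N}"] assms
    unfolding least_rhs_def by auto
qed

text \<open>Collapsing only selects rules from \<open>N\<close>, so whatever holds of the rules in
  \<open>N\<close> carries over.\<close>

lemma collapsed_flat_rules_iff:
  "(l, r) \<in> collapsed_flat_rules gt N \<longleftrightarrow> (l, r) \<in> N \<and> r = Const (least_rhs gt N l)"
proof -
  have "\<exists>d. (l, Const d) \<in> N" if "l \<in> Domain N"
    using that replaced_flat_rule_cases by fastforce
  then show ?thesis
    unfolding collapsed_flat_rules_def by (auto dest: least_rhs_props)
qed

section \<open>The rules and pending equations after one pass\<close>

lemma update_pass_rules_iff:
  "(l, r) \<in> R' \<longleftrightarrow> (\<exists>c \<in> C. c \<noteq> rep gt R A c \<and> l = Const c \<and> r = Const (rep gt R A c)) \<or>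
     ((l, r) \<in> N \<and> r = Const (least_rhs gt N l))"
  by (auto simp: update_pass_def Let_def merged_const_rules_def collapsed_flat_rules_iff)

lemma update_pass_eqs_iff:
  "(a, b) \<in> A' \<longleftrightarrow> (\<exists>l. (l, Const a) \<in> N \<and> a \<noteq> b \<and> b = least_rhs gt N l)"
  by (auto simp: update_pass_def Let_def new_const_eqs_def)

lemma update_pass_const_flat: "const_flat_system C gt F ar R'"
  unfolding const_flat_system_def
proof clarify
  fix l r assume "(l, r) \<in> R'" "\<not> is_flat_rule C F ar l r"
  then show "is_const_rule C gt l r"
    unfolding update_pass_rules_iff
  proof (elim disjE bexE conjE)
    fix c assume "c \<in> C" "c \<noteq> rep gt R A c" "l = Const c" "r = Const (rep gt R A c)"
    then show ?thesis
      using rep_in_C rep_gt[OF _ merged_class_refl] unfolding is_const_rule_def by blast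
  next
    assume "(l, r) \<in> N" "\<not> is_flat_rule C F ar l r"
    then show ?thesis using replaced_flat_rule_cases unfolding is_flat_rule_def by blast
  qed
qed

text \<open>Left sides in \<open>N\<close> are applications, so only the merged constant rules
  count: within \<open>C\<close>, the irreducible constants are exactly the representatives.\<close>

lemma Const_in_Domain_update_pass_iff:
  "Const c \<in> Domain R' \<longleftrightarrow> c \<in> C \<and> c \<noteq> rep gt R A c"
proof -
  have "(Const c, r) \<notin> N" for r using replaced_flat_rule_cases by fastforce
  then show ?thesis by (auto simp: Domain_iff update_pass_rules_iff)
qed

lemma update_pass_interreduced: "interreduced R'"
proof -
  have N: "\<exists>h ts. l = App h ts" if "(l, r) \<in> N" for l r
    using replaced_flat_rule_cases[OF that] by blast
  have "single_valued R'"
    by (rule single_valuedI) (auto simp: update_pass_rules_iff dest: N)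
  moreover have "Const d \<notin> Domain R'" if "(l, Const d) \<in> R'" for l d
    using that replaced_flat_rule_cases[of l "Const d"] rep_idem
    unfolding Const_in_Domain_update_pass_iff update_pass_rules_iff by auto
  moreover have "Const c \<notin> Domain R'" if "(App h (map Const cs), r) \<in> R'" "c \<in> set cs" for h cs r c
  proof -
    have "(App h (map Const cs), r) \<in> N" using that(1) by (auto simp: update_pass_rules_iff)
    from replaced_flat_rule_cases[OF this] that(2) have "rep gt R A c = c"
      by (auto simp: map_Const_eq_iff)
    then show ?thesis by (simp add: Const_in_Domain_update_pass_iff)
  qed
  ultimately show ?thesis unfolding interreduced_def by blast
qed

text \<open>Both sides occur as right sides in \<open>N\<close> and hence are representatives. The
  next pass needs this for its strict decrease.\<close>

lemma update_pass_eqs: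
  assumes "(a, b) \<in> A'"
  shows "a \<noteq> b" "a \<in> C" "b \<in> C" "Const a \<notin> Domain R'" "Const b \<notin> Domain R'"
proof -
  obtain l where l: "(l, Const a) \<in> N" "a \<noteq> b" "b = least_rhs gt N l"
    using assms update_pass_eqs_iff by blast
  then have "(l, Const b) \<in> N" using least_rhs_props by blast
  with l show "a \<noteq> b" "a \<in> C" "b \<in> C" "Const a \<notin> Domain R'" "Const b \<notin> Domain R'"
    using replaced_flat_rule_cases[of l "Const a"] replaced_flat_rule_cases[of l "Const b"]
    unfolding Const_in_Domain_update_pass_iff by auto
qed

section \<open>Preservation of the congruence closure\<close>

lemma CC_map_rep:
  assumes "\<And>c. c \<in> C \<Longrightarrow> (Const c, Const (rep gt R A c)) \<in> CC C F ar E"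
    and "h \<in> F" "length cs = ar h" "set cs \<subseteq> C"
  shows "(App h (map Const cs), App h (map Const (map (rep gt R A) cs))) \<in> CC C F ar E"
  using assms by (intro CC.cong) (auto simp: subset_iff)

lemma update_pass_CC:
  "CC C F ar (R' \<union> const_eqs A') = CC C F ar (R \<union> const_eqs A)"
proof
  let ?E = "R \<union> const_eqs A" and ?E' = "R' \<union> const_eqs A'"
  have rep: "(Const c, Const (rep gt R A c)) \<in> CC C F ar ?E" if "c \<in> C" for c
    using merged_class_props rep_in_class that by blast
  have N: "(l, r) \<in> CC C F ar ?E" if lr: "(l, r) \<in> N" for l r
  proof -
    obtain h cs d where *: "l = App h (map Const (map (rep gt R A) cs))"
      "r = Const (rep gt R A d)" "(App h (map Const cs), Const d) \<in> R"
      using lr unfolding replaced_flat_rules_def by auto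
    then have "h \<in> F" "length cs = ar h" "set cs \<subseteq> C" "d \<in> C"
      using flat_rule_cases[OF *(3)] by (auto simp: map_Const_eq_iff)
    then show ?thesis
      using CC_map_rep[of ?E h cs] rep * by (blast intro: CC.base CC.sym CC.trans)
  qed
  show "CC C F ar ?E' \<subseteq> CC C F ar ?E"
  proof (rule CC_subsetI, rule Un_least)
    show "R' \<subseteq> CC C F ar ?E"
      using rep N by (auto simp: update_pass_rules_iff)
    show "const_eqs A' \<subseteq> CC C F ar ?E"
    proof -
      \<comment> \<open>Both constants are congruent to the left side that their flat rules
        share.\<close>
      have "(Const a, Const b) \<in> CC C F ar ?E" if "(a, b) \<in> A'" for a b
        using that N least_rhs_props unfolding update_pass_eqs_iff
        by (blast intro: CC.trans CC.sym)
      then show ?thesis unfolding const_eqs_def by auto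
    qed
  qed
  have rep': "(Const c, Const (rep gt R A c)) \<in> CC C F ar ?E'" if "c \<in> C" for c
    using that by (cases "c = rep gt R A c")
      (auto simp: update_pass_rules_iff intro: CC.base CC.refl ground_terms.const)
  have cls: "(Const a, Const b) \<in> CC C F ar ?E'"
    if "b \<in> merged_class R A a" "a \<in> C" for a b
  proof -
    have "b \<in> C" using that merged_class_props by blast
    then show ?thesis using rep'[of a] rep'[of b] rep_eq[OF that(1)] that(2)
      by (metis CC.sym CC.trans)
  qed
  \<comment> \<open>A flat rule dropped by the collapse is recovered from the kept rule with the
    same left side and the equation generated for the dropped one.\<close>
  have N': "(l, Const d) \<in> CC C F ar ?E'" if "(l, Const d) \<in> N" for l d
  proof -
    have 1: "(l, Const (least_rhs gt N l)) \<in> CC C F ar ?E'"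
      using least_rhs_props[OF that] by (auto simp: update_pass_rules_iff intro: CC.base)
    show ?thesis
    proof (cases "d = least_rhs gt N l")
      case False
      then have "(d, least_rhs gt N l) \<in> A'" using that by (auto simp: update_pass_eqs_iff)
      then have "(Const d, Const (least_rhs gt N l)) \<in> CC C F ar ?E'"
        by (auto simp: const_eqs_def intro: CC.base)
      with 1 show ?thesis by (blast intro: CC.sym CC.trans)
    qed (use 1 in simp)
  qed
  show "CC C F ar ?E \<subseteq> CC C F ar ?E'"
  proof (rule CC_subsetI, rule Un_least)
    show "R \<subseteq> CC C F ar ?E'"
    proof clarify
      fix l r assume lr: "(l, r) \<in> R"
      with cf show "(l, r) \<in> CC C F ar ?E'"
      proof (cases rule: const_flat_cases)
        case (const c d)
        then show ?thesis using cls merged_class_const_rule lr by blast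
      next
        case (flat h cs d)
        then have "(App h (map Const (map (rep gt R A) cs)), Const (rep gt R A d)) \<in> N"
          using lr unfolding replaced_flat_rules_def by blast
        then have "(App h (map Const (map (rep gt R A) cs)), Const (rep gt R A d)) \<in> CC C F ar ?E'"
          by (rule N')
        then show ?thesis
          using CC_map_rep[of ?E' h cs] rep' flat by (blast intro: CC.sym CC.trans)
      qed
    qed
    show "const_eqs A \<subseteq> CC C F ar ?E'"
      using cls merged_class_eqn A by (auto simp: const_eqs_def)
  qed
qed

text \<open>Reducible constants stay reducible. A pending equation merges two distinct irreducible
  constants under one representative, so at least one of them becomes reducible.\<close>

lemma update_pass_irreducible_consts_less:
  assumes "A \<noteq> {}"
    and "\<And>a b. (a, b) \<in> A \<Longrightarrow> a \<noteq> b \<and> Const a \<notin> Domain R \<and> Const b \<notin> Domain R"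
  shows "card {c \<in> C. Const c \<notin> Domain R'} < card {c \<in> C. Const c \<notin> Domain R}"
proof (rule psubset_card_mono)
  have "Const c \<in> Domain R'" if c: "c \<in> C" "Const c \<in> Domain R" for c
  proof -
    obtain d where d: "(Const c, Const d) \<in> R" "(c, d) \<in> gt"
      using c(2) const_rule_cases by blast
    \<comment> \<open>The old rule puts the smaller \<open>d\<close> into the class of
      \<open>c\<close>, so \<open>c\<close> cannot be its least element.\<close>
    have "c \<noteq> rep gt R A c"
    proof
      assume eq: "c = rep gt R A c"
      have "trans gt" "irrefl gt" using ord unfolding strict_linear_order_on_def by auto
      moreover from this have "d \<noteq> c" using d by (auto simp: irrefl_def)
      moreover have "(d, c) \<in> gt"
        using rep_gt[OF that(1) merged_class_const_rule[OF d(1)]] eq \<open>d \<noteq> c\<close> by simp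
      ultimately show False using d(2) by (meson irrefl_def transD)
    qed
    then show ?thesis using that by (simp add: Const_in_Domain_update_pass_iff)
  qed
  then have "{c \<in> C. Const c \<notin> Domain R'} \<subseteq> {c \<in> C. Const c \<notin> Domain R}" by blast
  moreover obtain a b where ab: "(a, b) \<in> A" using assms(1) by auto
  moreover have "a \<in> C" "b \<in> C" using ab A by auto
  moreover have "a \<noteq> rep gt R A a \<or> b \<noteq> rep gt R A b"
    using assms(2)[OF ab] rep_eq[OF merged_class_eqn[OF ab]] by metis
  ultimately show "{c \<in> C. Const c \<notin> Domain R'} \<subset> {c \<in> C. Const c \<notin> Domain R}"
    using assms(2)[OF ab] by (auto simp: Const_in_Domain_update_pass_iff)
qed (simp add: fin)

end

section \<open>The iteration\<close>

text \<open>\<open>E\<close> is the fixed initial equation set and \<open>A\<close> the pending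
  equations. The clause on distinct irreducible constants drives termination; the last clause
  carries correctness.\<close>

definition update_inv ::
    "'c set \<Rightarrow> 'c rel \<Rightarrow> 'f set \<Rightarrow> ('f \<Rightarrow> nat) \<Rightarrow> ('c, 'f) rules \<Rightarrow>
      ('c, 'f) rules \<times> ('c \<times> 'c) set \<Rightarrow> bool"
where
  "update_inv C gt F ar E = (\<lambda>(R, A).
     const_flat_system C gt F ar R \<and> interreduced R \<and> A \<subseteq> C \<times> C \<and>
     (\<forall>(a, b) \<in> A. a \<noteq> b \<and> Const a \<notin> Domain R \<and> Const b \<notin> Domain R) \<and>
     CC C F ar (R \<union> const_eqs A) = CC C F ar E)"

text \<open>The hypotheses already hold of the raw input, so the same fact establishes the invariant
  before the loop and preserves it in each round.\<close>

lemma update_inv_update_pass: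
  assumes "finite C" "strict_linear_order_on C gt" "const_flat_system C gt F ar R" "A \<subseteq> C \<times> C"
    and "CC C F ar (R \<union> const_eqs A) = CC C F ar E"
  shows "update_inv C gt F ar E (update_pass C gt (R, A))"
proof -
  let ?R' = "fst (update_pass C gt (R, A))" and ?A' = "snd (update_pass C gt (R, A))"
  have "\<forall>(a, b) \<in> ?A'. a \<noteq> b \<and> Const a \<notin> Domain ?R' \<and> Const b \<notin> Domain ?R'"
    using update_pass_eqs[OF assms(1-4)] by blast
  moreover have "?A' \<subseteq> C \<times> C" using update_pass_eqs(2,3)[OF assms(1-4)] by auto
  ultimately show ?thesis
    using update_pass_const_flat[OF assms(1-4)] update_pass_interreduced[OF assms(1-4)]
      update_pass_CC[OF assms(1-4)] assms(5)
    unfolding update_inv_def by (simp add: case_prod_beta)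
qed

lemma update_U_terminates:
  assumes "finite C" "strict_linear_order_on C gt" "const_flat_system C gt F ar R" "A \<subseteq> C \<times> C"
  shows "\<exists>R'. update_U C gt R A = Some R' \<and> update_inv C gt F ar (R \<union> const_eqs A) (R', {})"
proof -
  let ?E = "R \<union> const_eqs A"
  let ?I = "update_inv C gt F ar ?E"
  let ?b = "\<lambda>(R, A). A \<noteq> {}"
  let ?m = "\<lambda>(R, A). card {c \<in> C. Const c \<notin> Domain R}"
  let ?s = "update_pass C gt (R, A)"
  \<comment> \<open>The invariant starts only after the first pass: given equations may be trivial
    or involve reducible constants.\<close>
  have init: "?I ?s" using assms by (rule update_inv_update_pass) simp
  have step: "?I (update_pass C gt S)" if "?I S" for S
  proof (cases S)
    case (Pair R1 A1)
    then have "const_flat_system C gt F ar R1" "A1 \<subseteq> C \<times> C"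
      "CC C F ar (R1 \<union> const_eqs A1) = CC C F ar ?E"
      using that by (auto simp: update_inv_def)
    then show ?thesis using Pair update_inv_update_pass[OF assms(1,2)] by blast
  qed
  have dec: "?m (update_pass C gt S) < ?m S" if "?I S" "?b S" for S
  proof (cases S)
    case (Pair R1 A1)
    then have "const_flat_system C gt F ar R1" "A1 \<subseteq> C \<times> C" "A1 \<noteq> {}"
      "\<And>a b. (a, b) \<in> A1 \<Longrightarrow> a \<noteq> b \<and> Const a \<notin> Domain R1 \<and> Const b \<notin> Domain R1"
      using that unfolding update_inv_def by blast+
    from update_pass_irreducible_consts_less[OF assms(1,2) this]
    show ?thesis by (simp add: Pair case_prod_beta)
  qed
  have "\<exists>S. while_option ?b (update_pass C gt) ?s = Some S"
    by (rule measure_while_option_Some[where P = ?I and f = ?m])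
      (use init step dec in blast)+
  then obtain S where S: "while_option ?b (update_pass C gt) ?s = Some S" by blast
  then have "?I S" using while_option_rule[OF _ S, of ?I] init step by blast
  moreover have "snd S = {}" using while_option_stop[OF S] by auto
  ultimately show ?thesis using S by (cases S) (auto simp: update_U_def)
qed

theorem theorem6p1:
  fixes C :: "'c set" and gt :: "'c rel"
    and F :: "'f set" and ar :: "'f \<Rightarrow> nat"
    and R :: "('c, 'f) rules" and A :: "('c \<times> 'c) set"
  assumes "finite C"
    and "strict_linear_order_on C gt"
    and "const_flat_system C gt F ar R"
    and "canonical C F ar R"
    and "reduced C F ar R"
    and "finite A"
    and "A \<subseteq> C \<times> C"
  shows "\<exists>R'. update_U C gt R A = Some R' \<and>
    const_flat_system C gt F ar R' \<and>
    canonical C F ar R' \<and>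
    reduced C F ar R' \<and>
    (\<forall>s \<in> ground_terms C F ar. \<forall>t \<in> ground_terms C F ar.
       (s, t) \<in> CC C F ar (R \<union> const_eqs A) \<longleftrightarrow> same_normal_form C F ar R' s t) \<and>
    (\<forall>s \<in> ground_terms C F ar. \<forall>t \<in> ground_terms C F ar. \<forall>s' t'.
       flattens_to C F ar R s s' \<longrightarrow> flattens_to C F ar R t t' \<longrightarrow>
       ((s, t) \<in> CC C F ar (R \<union> const_eqs A) \<longleftrightarrow> same_normal_form C F ar R' s' t'))"
proof -
  let ?G = "ground_terms C F ar" and ?CC = "CC C F ar (R \<union> const_eqs A)"
  obtain R' where R': "update_U C gt R A = Some R'"
    and inv: "update_inv C gt F ar (R \<union> const_eqs A) (R', {})"
    using update_U_terminates[OF assms(1,2,3,7)] by blast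
  have cf: "const_flat_system C gt F ar R'" and ir: "interreduced R'"
    and CC: "CC C F ar R' = ?CC"
    using inv by (auto simp: update_inv_def const_eqs_def)
  have can: "canonical C F ar R'"
    unfolding canonical_def
    using const_flat_terminating[OF assms(1,2) cf] interreduced_confluent[OF cf ir] by blast
  have main: "(s, t) \<in> ?CC \<longleftrightarrow> same_normal_form C F ar R' s t" if "s \<in> ?G" "t \<in> ?G" for s t
    using CC_iff_same_normal_form[OF cf ir that] CC by simp
  \<comment> \<open>Flattening uses flat rules of the original \<open>R\<close>, whose equations
    belong to the closure, so replacing terms by flattened forms does not affect congruence.\<close>
  have flatten: "s' \<in> ?G \<and> (s, s') \<in> ?CC" if "s \<in> ?G" "flattens_to C F ar R s s'" for s s'
  proof -
    let ?Q = "{(l, r) \<in> R. is_flat_rule C F ar l r}"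
    have st: "(rewrite_step C F ar ?Q)\<^sup>*\<^sup>* s s'" using that(2) by (simp add: flattens_to_def)
    have "CC C F ar ?Q \<subseteq> ?CC" by (rule CC_mono) auto
    then show ?thesis
      using rewrite_steps_ground[OF st that(1)] rewrite_steps_imp_CC[OF st that(1)] by blast
  qed
  have "(s, t) \<in> ?CC \<longleftrightarrow> same_normal_form C F ar R' s' t'"
    if "s \<in> ?G" "t \<in> ?G" "flattens_to C F ar R s s'" "flattens_to C F ar R t t'" for s t s' t'
    using main[of s' t'] flatten[OF that(1,3)] flatten[OF that(2,4)]
    by (meson CC.sym CC.trans)
  then show ?thesis
    using R' cf can interreduced_reduced[OF cf ir] main by blast
qed

end
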